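(* In general $|\psi_{\triangle,H}\rangle$ need not be LU equivalent to the GHZ state: there exist an integer $d\ge 2$ and a symmetric $d\times d$ complex Hadamard matrix $H$ such that the generalized graph state $|\psi_{\triangle,H}\rangle$ of the triangle graph $\triangle$ is not LU equivalent to $|\mathrm{GHZ}_{3,d}\rangle$.
   Context: A complex Hadamard matrix of size $d$ is a $d\times d$ complex matrix $H=(h_{ij})_{i,j=0}^{d-1}$ with $|h_{ij}|=1$ for all $i,j$ and $H^\dagger H=dI_d$; it is symmetric if $H=H^T$. A qudit has state space $\mathbb{C}^d$ with computational basis $|0\rangle,\dots,|d-1\rangle$. For symmetric $H$, the generalized controlled-$Z$ gate $C^H$ is the diagonal operator on $\mathbb{C}^d\otimes\mathbb{C}^d$ with $C^H|ij\rangle=h_{ij}|ij\rangle$; $C^H_{ab}$ denotes this gate acting on qudits $a,b$. The triangle graph $\triangle$ has vertices $1,2,3$ and edges $(12),(23),(13)$, and its generalized graph state is the three-qudit state $$|\psi_{\triangle,H}\rangle=\frac{1}{d^{3/2}}C^H_{12}C^H_{23}C^H_{13}H^{\otimes 3}|0\rangle^{\otimes 3}.$$ The three-qudit GHZ state is $|\mathrm{GHZ}_{3,d}\rangle=\frac{1}{\sqrt d}\sum_{i=0}^{d-1}|iii\rangle$. Two three-qudit states $|\psi_1\rangle,|\psi_2\rangle$ are LU (local unitary) equivalent if there are single-qudit unitaries $U_1,U_2,U_3$ with $(U_1\otimes U_2\otimes U_3)|\psi_1\rangle=|\psi_2\rangle$. *)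

theory Defs
  imports Complex_Main "Jordan_Normal_Form.Schur_Decomposition"
begin

section \<open>Hadamard and unitary matrices\<close>

definition complex_hadamard :: "nat \<Rightarrow> complex mat \<Rightarrow> bool" where
  "complex_hadamard d H \<longleftrightarrow>
     H \<in> carrier_mat d d \<and>
     (\<forall>i<d. \<forall>j<d. cmod (H $$ (i, j)) = 1) \<and>
     mat_adjoint H * H = of_nat d \<cdot>\<^sub>m 1\<^sub>m d"

definition symmetric_mat :: "complex mat \<Rightarrow> bool" where
  "symmetric_mat H \<longleftrightarrow> transpose_mat H = H"

definition unitary_mat :: "nat \<Rightarrow> complex mat \<Rightarrow> bool" where
  "unitary_mat d U \<longleftrightarrow> U \<in> carrier_mat d d \<and> mat_adjoint U * U = 1\<^sub>m d"


section \<open>Tensor products\<close>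

text \<open>
  Tensor products are Kronecker products, with the first factor most significant: the
  basis vector \<open>|ij\<rangle>\<close> has index \<open>i * d + j\<close> and \<open>|ijk\<rangle>\<close> has index
  \<open>i * d\<^sup>2 + j * d + k\<close>.
\<close>

definition kron_mat :: "complex mat \<Rightarrow> complex mat \<Rightarrow> complex mat" (infixr "\<otimes>\<^sub>m" 75) where
  "A \<otimes>\<^sub>m B = mat (dim_row A * dim_row B) (dim_col A * dim_col B)
     (\<lambda>(i, j). A $$ (i div dim_row B, j div dim_col B) * B $$ (i mod dim_row B, j mod dim_col B))"

definition kron_vec :: "complex vec \<Rightarrow> complex vec \<Rightarrow> complex vec" (infixr "\<otimes>\<^sub>v" 75) where
  "v \<otimes>\<^sub>v w = vec (dim_vec v * dim_vec w)
     (\<lambda>i. v $ (i div dim_vec w) * w $ (i mod dim_vec w))"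

definition ket3 :: "nat \<Rightarrow> nat \<Rightarrow> nat \<Rightarrow> nat \<Rightarrow> complex vec" where
  "ket3 d i j k = unit_vec d i \<otimes>\<^sub>v unit_vec d j \<otimes>\<^sub>v unit_vec d k"


section \<open>Gates acting on two of three qudits\<close>

text \<open>The level of qudit \<open>a \<in> {1, 2, 3}\<close> in the three-qudit basis vector with index \<open>x\<close>.\<close>

definition level :: "nat \<Rightarrow> nat \<Rightarrow> nat \<Rightarrow> nat" where
  "level d a x = x div d ^ (3 - a) mod d"

text \<open>
  \<open>on_qudits d a b G\<close> is the operator \<open>G\<close> on \<open>\<complex>\<^sup>d \<otimes> \<complex>\<^sup>d\<close> applied to qudits \<open>a\<close> and \<open>b\<close>
  (with \<open>a \<noteq> b\<close>), tensored with the identity on the remaining qudit.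
\<close>

definition on_qudits :: "nat \<Rightarrow> nat \<Rightarrow> nat \<Rightarrow> complex mat \<Rightarrow> complex mat" where
  "on_qudits d a b G = mat (d ^ 3) (d ^ 3) (\<lambda>(x, y).
     if \<forall>c \<in> {1, 2, 3} - {a, b}. level d c x = level d c y
     then G $$ (level d a x * d + level d b x, level d a y * d + level d b y)
     else 0)"

definition ctrl_gate :: "nat \<Rightarrow> complex mat \<Rightarrow> complex mat" where
  "ctrl_gate d H = mat (d * d) (d * d) (\<lambda>(x, y). if x = y then H $$ (x div d, x mod d) else 0)"


section \<open>Three-qudit states and local unitary equivalence\<close>

definition triangle_state :: "nat \<Rightarrow> complex mat \<Rightarrow> complex vec" where
  "triangle_state d H = complex_of_real (1 / real d powr (3 / 2)) \<cdot>\<^sub>v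
     ((on_qudits d 1 2 (ctrl_gate d H) * on_qudits d 2 3 (ctrl_gate d H) *
       on_qudits d 1 3 (ctrl_gate d H) * (H \<otimes>\<^sub>m H \<otimes>\<^sub>m H)) *\<^sub>v ket3 d 0 0 0)"

definition ghz_state :: "nat \<Rightarrow> complex vec" where
  "ghz_state d = complex_of_real (1 / sqrt (real d)) \<cdot>\<^sub>v
     finsum_vec TYPE(complex) (d ^ 3) (\<lambda>i. ket3 d i i i) {..<d}"

definition lu_equivalent :: "nat \<Rightarrow> complex vec \<Rightarrow> complex vec \<Rightarrow> bool" where
  "lu_equivalent d \<psi>\<^sub>1 \<psi>\<^sub>2 \<longleftrightarrow>
     (\<exists>U\<^sub>1 U\<^sub>2 U\<^sub>3. unitary_mat d U\<^sub>1 \<and> unitary_mat d U\<^sub>2 \<and> unitary_mat d U\<^sub>3 \<and>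
        (U\<^sub>1 \<otimes>\<^sub>m U\<^sub>2 \<otimes>\<^sub>m U\<^sub>3) *\<^sub>v \<psi>\<^sub>1 = \<psi>\<^sub>2)"


section \<open>Consistency of the conventions\<close>

lemma level_less: "d > 0 \<Longrightarrow> level d a x < d"
  by (simp add: level_def)

lemma dim_ket3 [simp]: "dim_vec (ket3 d i j k) = d ^ 3"
  by (simp add: ket3_def kron_vec_def power3_eq_cube)

lemma ket3_index:
  assumes "i < d" "j < d" "k < d" "x < d ^ 3"
  shows "ket3 d i j k $ x = (if level d 1 x = i \<and> level d 2 x = j \<and> level d 3 x = k then 1 else 0)"
proof -
  have d: "d > 0" using assms by simp
  have x: "x < d * (d * d)" using assms by (simp add: power3_eq_cube ac_simps)
  have m: "x mod (d * d) < d * d" "x mod (d * d) div d < d" "x div (d * d) < d"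
    using d x by (simp_all add: less_mult_imp_div_less)
  have e: "x mod (d * d) div d = x div d mod d" "x mod (d * d) mod d = x mod d"
    by (simp_all add: mod_mult2_eq d)
  show ?thesis
    using assms x m d unfolding ket3_def kron_vec_def level_def
    by (auto simp: e power2_eq_square)
qed

lemma ctrl_gate_ket:
  assumes "H \<in> carrier_mat d d" "i < d" "j < d"
  shows "ctrl_gate d H *\<^sub>v (unit_vec d i \<otimes>\<^sub>v unit_vec d j) =
    H $$ (i, j) \<cdot>\<^sub>v (unit_vec d i \<otimes>\<^sub>v unit_vec d j)"
proof (rule eq_vecI)
  fix x assume "x < dim_vec (H $$ (i, j) \<cdot>\<^sub>v (unit_vec d i \<otimes>\<^sub>v unit_vec d j))"
  then have x: "x < d * d" by (simp add: kron_vec_def)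
  have d: "x div d < d" "x mod d < d" using x assms by (simp_all add: less_mult_imp_div_less)
  let ?v = "unit_vec d i \<otimes>\<^sub>v unit_vec d j :: complex vec"
  have "dim_vec ?v = d * d" by (simp add: kron_vec_def)
  then have "(ctrl_gate d H *\<^sub>v ?v) $ x =
      (\<Sum>y = 0..<d * d. (if x = y then H $$ (x div d, x mod d) else 0) * ?v $ y)"
    using x by (simp add: ctrl_gate_def scalar_prod_def)
  also have "\<dots> = (\<Sum>y = 0..<d * d. if x = y then H $$ (x div d, x mod d) * ?v $ x else 0)"
    by (rule sum.cong) simp_all
  also have "\<dots> = H $$ (x div d, x mod d) * ?v $ x" using x by simp
  also have "\<dots> = (H $$ (i, j) \<cdot>\<^sub>v ?v) $ x" using x d assms by (auto simp: kron_vec_def)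
  finally show "(ctrl_gate d H *\<^sub>v ?v) $ x = (H $$ (i, j) \<cdot>\<^sub>v ?v) $ x" .
qed (simp add: ctrl_gate_def kron_vec_def)

lemma on_qudits_12:
  assumes "G \<in> carrier_mat (d * d) (d * d)"
  shows "on_qudits d 1 2 G = G \<otimes>\<^sub>m 1\<^sub>m d"
proof (rule eq_matI)
  fix x y assume "x < dim_row (G \<otimes>\<^sub>m 1\<^sub>m d)" "y < dim_col (G \<otimes>\<^sub>m 1\<^sub>m d)"
  then have xy: "x < d * d * d" "y < d * d * d" using assms by (auto simp: kron_mat_def)
  then have d: "d > 0" by (cases d) auto
  have "z div (d * d) mod d * d + z div d mod d = z div d" if "z < d * d * d" for z
  proof -
    have "z div (d * d) < d" using that d by (simp add: less_mult_imp_div_less ac_simps)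
    then show ?thesis by (simp add: div_mult2_eq)
  qed
  then show "on_qudits d 1 2 G $$ (x, y) = (G \<otimes>\<^sub>m 1\<^sub>m d) $$ (x, y)"
    using xy assms d
    by (auto simp: on_qudits_def kron_mat_def level_def power3_eq_cube power2_eq_square)
qed (use assms in \<open>auto simp: on_qudits_def kron_mat_def power3_eq_cube\<close>)

lemma on_qudits_23:
  assumes "G \<in> carrier_mat (d * d) (d * d)"
  shows "on_qudits d 2 3 G = 1\<^sub>m d \<otimes>\<^sub>m G"
proof (rule eq_matI)
  fix x y assume "x < dim_row (1\<^sub>m d \<otimes>\<^sub>m G)" "y < dim_col (1\<^sub>m d \<otimes>\<^sub>m G)"
  then have xy: "x < d * (d * d)" "y < d * (d * d)" using assms by (auto simp: kron_mat_def)
  then have d: "d > 0" by (cases d) auto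
  have "z div (d * d) < d" if "z < d * (d * d)" for z
    using that by (simp add: less_mult_imp_div_less)
  moreover have "z div d mod d * d + z mod d = z mod (d * d)" for z
    by (simp add: mod_mult2_eq)
  moreover have "{Suc 0, 2, 3} - {2, 3} = {Suc 0}" by auto
  ultimately show "on_qudits d 2 3 G $$ (x, y) = (1\<^sub>m d \<otimes>\<^sub>m G) $$ (x, y)"
    using xy assms d
    by (auto simp: on_qudits_def kron_mat_def level_def power3_eq_cube power2_eq_square)
qed (use assms in \<open>auto simp: on_qudits_def kron_mat_def power3_eq_cube\<close>)

lemma on_qudits_ctrl_gate:
  assumes "a \<in> {1, 2, 3}" "b \<in> {1, 2, 3}" "a \<noteq> b"
  shows "on_qudits d a b (ctrl_gate d H) =
    mat (d ^ 3) (d ^ 3) (\<lambda>(x, y). if x = y then H $$ (level d a x, level d b x) else 0)"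
proof (rule eq_matI)
  let ?D = "mat (d ^ 3) (d ^ 3) (\<lambda>(x, y). if x = y then H $$ (level d a x, level d b x) else 0)"
  fix x y assume "x < dim_row ?D" "y < dim_col ?D"
  then have xy: "x < d ^ 3" "y < d ^ 3" by auto
  then have d: "d > 0" by (cases d) auto
  have pair: "level d a z * d + level d b z < d * d" for z
  proof -
    have "level d a z * d + level d b z < (level d a z + 1) * d" using level_less[OF d] by simp
    also have "\<dots> \<le> d * d" using level_less[OF d, of a z] by (intro mult_le_mono1) simp
    finally show ?thesis .
  qed
  have digits: "z = level d 1 z * (d * d) + (level d 2 z * d + level d 3 z)" if "z < d ^ 3" for z
  proof -
    have "level d 1 z = z div (d * d)"
      using that
      by (simp add: level_def less_mult_imp_div_less power3_eq_cube power2_eq_square ac_simps)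
    moreover have "level d 2 z * d + level d 3 z = z mod (d * d)"
      by (simp add: level_def mod_mult2_eq)
    ultimately show ?thesis by (metis div_mult_mod_eq)
  qed
  have eq: "x = y \<longleftrightarrow> (\<forall>c \<in> {1, 2, 3}. level d c x = level d c y)"
  proof
    assume "\<forall>c \<in> {1, 2, 3}. level d c x = level d c y"
    then have "level d 1 x = level d 1 y" "level d 2 x = level d 2 y" "level d 3 x = level d 3 y"
      by blast+
    then show "x = y" using digits[OF xy(1)] digits[OF xy(2)] by presburger
  qed simp
  have "(level d a x * d + level d b x = level d a y * d + level d b y) \<longleftrightarrow>
      level d a x = level d a y \<and> level d b x = level d b y"
    (is "?l = ?r")
  proof
    assume e: ?l
    show ?r
      using arg_cong[OF e, of "\<lambda>n. n div d"] arg_cong[OF e, of "\<lambda>n. n mod d"] d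
      by (simp add: level_less)
  qed simp
  moreover have "(\<forall>c \<in> S. P c) \<longleftrightarrow> (\<forall>c \<in> S - {a, b}. P c) \<and> P a \<and> P b"
    if "a \<in> S" "b \<in> S" for S and P :: "nat \<Rightarrow> bool"
    using that by blast
  from this[OF assms(1,2), of "\<lambda>c. level d c x = level d c y"]
  have "x = y \<longleftrightarrow> (\<forall>c \<in> {1, 2, 3} - {a, b}. level d c x = level d c y) \<and>
      level d a x = level d a y \<and> level d b x = level d b y"
    unfolding eq .
  ultimately have key: "x = y \<longleftrightarrow> (\<forall>c \<in> {1, 2, 3} - {a, b}. level d c x = level d c y) \<and>
      level d a x * d + level d b x = level d a y * d + level d b y"
    by (simp only:)
  have "on_qudits d a b (ctrl_gate d H) $$ (x, y) =
      (if \<forall>c \<in> {1, 2, 3} - {a, b}. level d c x = level d c y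
       then if level d a x * d + level d b x = level d a y * d + level d b y
         then H $$ ((level d a x * d + level d b x) div d, (level d a x * d + level d b x) mod d)
         else 0
       else 0)"
    unfolding on_qudits_def ctrl_gate_def
    by (simp only: index_mat(1)[OF xy] index_mat(1)[OF pair pair] prod.case)
  also have "\<dots> = (if x = y then H $$ ((level d a x * d + level d b x) div d,
      (level d a x * d + level d b x) mod d) else 0)"
    unfolding key by (simp only: if_if_eq_conj)
  also have "\<dots> = ?D $$ (x, y)"
    using d level_less[OF d] xy by simp
  finally show "on_qudits d a b (ctrl_gate d H) $$ (x, y) = ?D $$ (x, y)" .
qed (auto simp: on_qudits_def)

end

theory Submission
  imports Defs
begin

text \<open>
  Let \<open>T\<^sub>i\<close> be the matrix of coefficients of a three-qudit state \<open>\<psi>\<close> for a fixed level \<open>i\<close> of the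
  first qudit. If \<open>\<psi>\<close> is LU equivalent to the GHZ state, then all \<open>T\<^sub>i\<close> become diagonal after
  multiplication by the same unitaries on the left and on the right, so
  \<open>T\<^sub>i T\<^sub>j\<^sup>\<dagger> T\<^sub>k = T\<^sub>k T\<^sub>j\<^sup>\<dagger> T\<^sub>i\<close>. For \<open>d = 6\<close> and \<open>H = \<i> I + C\<close>, where \<open>C\<close> is the symmetric Paley
  conference matrix built from the quadratic residues modulo \<open>5\<close>, this identity fails.
\<close>

section \<open>Kronecker products and composite indices\<close>

lemma composite_index_less:
  fixes i j m n :: nat
  assumes "i < m" "j < n"
  shows "i * n + j < m * n"
proof -
  have "i * n + j < (i + 1) * n" using assms by simp
  also have "\<dots> \<le> m * n" using assms by (intro mult_le_mono1) simp
  finally show ?thesis .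
qed

lemma sum_composite_index:
  fixes f :: "nat \<Rightarrow> 'a::comm_monoid_add"
  shows "(\<Sum>x<m * n. f x) = (\<Sum>i<m. \<Sum>j<n. f (i * n + j))"
proof -
  have "(\<Sum>x<m * n. f x) = (\<Sum>i<m. sum f {i * n..<i * n + n})"
    by (rule sum.nat_group[symmetric])
  also have "\<dots> = (\<Sum>i<m. \<Sum>j<n. f (i * n + j))"
  proof (rule sum.cong[OF refl])
    fix i
    show "sum f {i * n..<i * n + n} = (\<Sum>j<n. f (i * n + j))"
      using sum.shift_bounds_nat_ivl[of f 0 "i * n" n]
      by (simp add: add.commute lessThan_atLeast0)
  qed
  finally show ?thesis .
qed

lemma mult_mat_vec_index_sum:
  assumes "A \<in> carrier_mat m n" "v \<in> carrier_vec n" "i < m"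
  shows "(A *\<^sub>v v) $ i = (\<Sum>j<n. A $$ (i, j) * v $ j)"
  using assms by (auto simp: scalar_prod_def lessThan_atLeast0)

lemma kron_mat_carrier [intro]:
  assumes "A \<in> carrier_mat m n" "B \<in> carrier_mat p q"
  shows "A \<otimes>\<^sub>m B \<in> carrier_mat (m * p) (n * q)"
  using assms by (simp add: kron_mat_def)

text \<open>Cut \<open>v\<close> into \<open>n\<close> blocks of length \<open>q\<close>:
  \<open>B\<close> acts inside each block and \<open>A\<close> mixes the blocks. Keeping the action
  of \<open>B\<close> as a matrix-vector product lets the lemma be applied again when
  \<open>B\<close> is itself a Kronecker product.\<close>

lemma kron_mat_mult_vec_index:
  assumes A: "A \<in> carrier_mat m n" and B: "B \<in> carrier_mat p q"
    and v: "v \<in> carrier_vec (n * q)" and ij: "i < m" "j < p"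
  shows "((A \<otimes>\<^sub>m B) *\<^sub>v v) $ (i * p + j) =
    (\<Sum>k<n. A $$ (i, k) * (B *\<^sub>v vec q (\<lambda>l. v $ (k * q + l))) $ j)"
proof -
  have "((A \<otimes>\<^sub>m B) *\<^sub>v v) $ (i * p + j) =
      (\<Sum>k<n. \<Sum>l<q. (A \<otimes>\<^sub>m B) $$ (i * p + j, k * q + l) * v $ (k * q + l))"
    using mult_mat_vec_index_sum[OF kron_mat_carrier[OF A B] v composite_index_less[OF ij]]
    by (simp add: sum_composite_index)
  also have "\<dots> = (\<Sum>k<n. \<Sum>l<q. A $$ (i, k) * (B $$ (j, l) * v $ (k * q + l)))"
    using A B ij by (intro sum.cong refl) (simp add: kron_mat_def composite_index_less)
  also have "\<dots> = (\<Sum>k<n. A $$ (i, k) * (B *\<^sub>v vec q (\<lambda>l. v $ (k * q + l))) $ j)"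
    using mult_mat_vec_index_sum[OF B _ ij(2)] by (simp add: sum_distrib_left)
  finally show ?thesis .
qed

text \<open>The position of the basis vector |ijk>. The grouping follows the right-associated
  Kronecker product, with \<open>j * d + k\<close> as the index inside the last two factors.\<close>

definition idx3 :: "nat \<Rightarrow> nat \<Rightarrow> nat \<Rightarrow> nat \<Rightarrow> nat" where
  "idx3 d i j k = i * (d * d) + (j * d + k)"

lemma idx3_less:
  assumes "i < d" "j < d" "k < d"
  shows "idx3 d i j k < d ^ 3"
  using assms by (simp add: idx3_def composite_index_less power3_eq_cube mult.assoc)

lemma level_idx3:
  assumes "i < d" "j < d" "k < d"
  shows "level d 1 (idx3 d i j k) = i" "level d 2 (idx3 d i j k) = j"
    "level d 3 (idx3 d i j k) = k"
proof -
  have "j * d + k < d * d" using assms by (simp add: composite_index_less)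
  then show "level d 1 (idx3 d i j k) = i"
    using assms by (simp add: level_def idx3_def power2_eq_square)
  \<comment> \<open>Levels 2 and 3 come from quotient and remainder by \<open>d\<close>, so they
    need Horner form; level 1 uses the grouping by \<open>d * d\<close>.\<close>
  have "idx3 d i j k = (i * d + j) * d + k"
    by (simp add: idx3_def algebra_simps)
  then show "level d 2 (idx3 d i j k) = j" "level d 3 (idx3 d i j k) = k"
    using assms by (simp_all add: level_def)
qed

text \<open>The sums stay nested so that each layer is a linear system in a single factor; the local
  unitaries can then be inverted one at a time.\<close>

lemma kron3_mult_vec_index:
  assumes A: "A \<in> carrier_mat d d" and B: "B \<in> carrier_mat d d" and C: "C \<in> carrier_mat d d"
    and v: "v \<in> carrier_vec (d ^ 3)" and abc: "a < d" "b < d" "c < d"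
  shows "((A \<otimes>\<^sub>m B \<otimes>\<^sub>m C) *\<^sub>v v) $ idx3 d a b c =
    (\<Sum>i<d. A $$ (a, i) * (\<Sum>j<d. B $$ (b, j) * (\<Sum>k<d. C $$ (c, k) * v $ idx3 d i j k)))"
proof -
  have v': "v \<in> carrier_vec (d * (d * d))" using v by (simp add: power3_eq_cube mult.assoc)
  have "((A \<otimes>\<^sub>m B \<otimes>\<^sub>m C) *\<^sub>v v) $ idx3 d a b c =
      (\<Sum>i<d. A $$ (a, i) * ((B \<otimes>\<^sub>m C) *\<^sub>v vec (d * d) (\<lambda>x. v $ (i * (d * d) + x))) $ (b * d + c))"
    unfolding idx3_def
    by (rule kron_mat_mult_vec_index[OF A kron_mat_carrier[OF B C] v'])
      (use abc in \<open>simp_all add: composite_index_less\<close>)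
  also have "\<dots> = (\<Sum>i<d. A $$ (a, i) * (\<Sum>j<d. B $$ (b, j) *
      (\<Sum>k<d. C $$ (c, k) * v $ idx3 d i j k)))"
  proof (intro sum.cong refl arg_cong2[where f = "(*)"])
    fix i
    let ?w = "vec (d * d) (\<lambda>x. v $ (i * (d * d) + x))"
    have "((B \<otimes>\<^sub>m C) *\<^sub>v ?w) $ (b * d + c) =
        (\<Sum>j<d. B $$ (b, j) * (C *\<^sub>v vec d (\<lambda>k. ?w $ (j * d + k))) $ c)"
      by (rule kron_mat_mult_vec_index[OF B C _ abc(2,3)]) simp
    also have "\<dots> = (\<Sum>j<d. B $$ (b, j) * (\<Sum>k<d. C $$ (c, k) * v $ idx3 d i j k))"
      using mult_mat_vec_index_sum[OF C _ abc(3)]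
      by (intro sum.cong refl arg_cong2[where f = "(*)"])
        (simp add: idx3_def composite_index_less)
    finally show "((B \<otimes>\<^sub>m C) *\<^sub>v ?w) $ (b * d + c) =
        (\<Sum>j<d. B $$ (b, j) * (\<Sum>k<d. C $$ (c, k) * v $ idx3 d i j k))" .
  qed
  finally show ?thesis .
qed

section \<open>Coefficients of the two states\<close>

lemma ket3_idx3:
  assumes "i < d" "j < d" "k < d" "a < d" "b < d" "c < d"
  shows "ket3 d i j k $ idx3 d a b c = (if a = i \<and> b = j \<and> c = k then 1 else 0)"
  using assms by (simp only: ket3_index[OF assms(1-3) idx3_less] level_idx3)

lemma ghz_state_idx3:
  assumes "a < d" "b < d" "c < d"
  shows "ghz_state d $ idx3 d a b c =
    complex_of_real (1 / sqrt (real d)) * (if a = b \<and> b = c then 1 else 0)"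
proof -
  have ket: "(\<lambda>i. ket3 d i i i) \<in> {..<d} \<rightarrow> carrier_vec (d ^ 3)"
    by (auto intro!: carrier_vecI)
  have "finsum_vec TYPE(complex) (d ^ 3) (\<lambda>i. ket3 d i i i) {..<d} $ idx3 d a b c =
      (\<Sum>i<d. ket3 d i i i $ idx3 d a b c)"
    using idx3_less[OF assms] ket by (simp add: index_finsum_vec)
  also have "\<dots> = (\<Sum>i<d. if i = a then if a = b \<and> b = c then 1 else 0 else 0)"
    using assms by (intro sum.cong refl) (auto simp: ket3_idx3)
  also have "\<dots> = (if a = b \<and> b = c then 1 else 0)" using assms by simp
  finally show ?thesis
    using idx3_less[OF assms] finsum_vec_closed[OF ket]
    by (simp add: ghz_state_def)
qed

section \<open>Coefficients of the triangle state\<close>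

lemma diag_mult_vec_index:
  fixes v :: "'a::semiring_1 vec"
  assumes "v \<in> carrier_vec n" "x < n"
  shows "(mat n n (\<lambda>(x, y). if x = y then f x else 0) *\<^sub>v v) $ x = f x * v $ x"
proof -
  have "(mat n n (\<lambda>(x, y). if x = y then f x else 0) *\<^sub>v v) $ x =
      (\<Sum>y = 0..<n. (if x = y then f x else 0) * v $ y)"
    using assms by (auto simp: scalar_prod_def intro!: sum.cong)
  also have "\<dots> = (\<Sum>y = 0..<n. if x = y then f x * v $ x else 0)"
    by (intro sum.cong refl) auto
  finally show ?thesis using assms by simp
qed

text \<open>The coefficient of |ijk> without normalization: the first three factors come from the
  edges of the triangle, the last three from \<open>H\<close> applied to |0> on each qudit.\<close>

definition triangle_coeff :: "complex mat \<Rightarrow> nat \<Rightarrow> nat \<Rightarrow> nat \<Rightarrow> complex" where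
  "triangle_coeff H i j k =
     H $$ (i, j) * H $$ (j, k) * H $$ (i, k) * H $$ (i, 0) * H $$ (j, 0) * H $$ (k, 0)"

lemma on_qudits_carrier [simp]: "on_qudits d a b G \<in> carrier_mat (d ^ 3) (d ^ 3)"
  by (simp add: on_qudits_def)

lemma on_qudits_ctrl_gate_mult_vec_index:
  assumes "a \<in> {1, 2, 3}" "b \<in> {1, 2, 3}" "a \<noteq> b" "v \<in> carrier_vec (d ^ 3)" "x < d ^ 3"
  shows "(on_qudits d a b (ctrl_gate d H) *\<^sub>v v) $ x = H $$ (level d a x, level d b x) * v $ x"
  unfolding on_qudits_ctrl_gate[OF assms(1-3)]
  using assms(4,5) by (rule diag_mult_vec_index)

lemma triangle_state_carrier: "triangle_state d H \<in> carrier_vec (d ^ 3)"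
  by (rule carrier_vecI) (simp add: triangle_state_def on_qudits_def)

lemma triangle_state_idx3:
  assumes H: "H \<in> carrier_mat d d" and ijk: "i < d" "j < d" "k < d"
  shows "triangle_state d H $ idx3 d i j k =
    complex_of_real (1 / real d powr (3 / 2)) * triangle_coeff H i j k"
proof -
  let ?x = "idx3 d i j k"
  let ?K = "H \<otimes>\<^sub>m H \<otimes>\<^sub>m H" and ?z = "ket3 d 0 0 0"
  have d: "0 < d" using ijk by simp
  have x: "?x < d ^ 3" using idx3_less[OF ijk] .
  have K: "?K \<in> carrier_mat (d ^ 3) (d ^ 3)"
    using kron_mat_carrier[OF H kron_mat_carrier[OF H H]] by (simp add: power3_eq_cube mult.assoc)
  have z: "?z \<in> carrier_vec (d ^ 3)" by (simp add: carrier_vecI)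
  have Kz: "?K *\<^sub>v ?z \<in> carrier_vec (d ^ 3)" using K z by simp
  define A B C where
    "A = on_qudits d 1 2 (ctrl_gate d H)" and
    "B = on_qudits d 2 3 (ctrl_gate d H)" and
    "C = on_qudits d 1 3 (ctrl_gate d H)"
  have ABC: "A \<in> carrier_mat (d ^ 3) (d ^ 3)" "B \<in> carrier_mat (d ^ 3) (d ^ 3)"
    "C \<in> carrier_mat (d ^ 3) (d ^ 3)"
    by (simp_all add: A_def B_def C_def)
  \<comment> \<open>Only \<open>a = b = c = 0\<close> survives, so each qudit contributes an entry
    of column 0 of \<open>H\<close>.\<close>
  have "(?K *\<^sub>v ?z) $ ?x = (\<Sum>a<d. H $$ (i, a) * (\<Sum>b<d. H $$ (j, b) *
      (\<Sum>c<d. H $$ (k, c) * ?z $ idx3 d a b c)))"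
    by (rule kron3_mult_vec_index[OF H H H z ijk])
  also have "\<dots> = (\<Sum>a<d. H $$ (i, a) * (\<Sum>b<d. H $$ (j, b) *
      (\<Sum>c<d. if c = 0 then if a = 0 \<and> b = 0 then H $$ (k, 0) else 0 else 0)))"
    using d by (intro sum.cong refl arg_cong2[where f = "(*)"]) (auto simp: ket3_idx3)
  also have "\<dots> = (\<Sum>a<d. H $$ (i, a) *
      (\<Sum>b<d. if b = 0 then if a = 0 then H $$ (j, 0) * H $$ (k, 0) else 0 else 0))"
    using d by (intro sum.cong refl arg_cong2[where f = "(*)"]) auto
  also have "\<dots> = (\<Sum>a<d. if a = 0 then H $$ (i, 0) * (H $$ (j, 0) * H $$ (k, 0)) else 0)"
    using d by (intro sum.cong refl) auto
  also have "\<dots> = H $$ (i, 0) * (H $$ (j, 0) * H $$ (k, 0))" using d by simp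
  finally have start: "(?K *\<^sub>v ?z) $ ?x = H $$ (i, 0) * (H $$ (j, 0) * H $$ (k, 0))" .
  have "(A * B * C * ?K) *\<^sub>v ?z = A *\<^sub>v (B *\<^sub>v (C *\<^sub>v (?K *\<^sub>v ?z)))"
    using ABC K z Kz by (simp add: assoc_mult_mat_vec[where n\<^sub>1 = "d ^ 3" and n\<^sub>2 = "d ^ 3" and n\<^sub>3 = "d ^ 3"])
  \<comment> \<open>The gates are diagonal: each multiplies the coefficient at \<open>?x\<close> by
    the entry of \<open>H\<close> at its two levels.\<close>
  moreover have "(A *\<^sub>v (B *\<^sub>v (C *\<^sub>v (?K *\<^sub>v ?z)))) $ ?x =
      H $$ (i, j) * (H $$ (j, k) * (H $$ (i, k) * (?K *\<^sub>v ?z) $ ?x))"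
  proof -
    have C: "C *\<^sub>v (?K *\<^sub>v ?z) \<in> carrier_vec (d ^ 3)" using ABC Kz by simp
    have B: "B *\<^sub>v (C *\<^sub>v (?K *\<^sub>v ?z)) \<in> carrier_vec (d ^ 3)" using ABC C by simp
    have "(C *\<^sub>v (?K *\<^sub>v ?z)) $ ?x = H $$ (i, k) * (?K *\<^sub>v ?z) $ ?x"
      using on_qudits_ctrl_gate_mult_vec_index[OF _ _ _ Kz x, of 1 3 H]
      by (simp only: C_def level_idx3[OF ijk]) simp
    moreover have "(B *\<^sub>v (C *\<^sub>v (?K *\<^sub>v ?z))) $ ?x = H $$ (j, k) * (C *\<^sub>v (?K *\<^sub>v ?z)) $ ?x"
      using on_qudits_ctrl_gate_mult_vec_index[OF _ _ _ C x, of 2 3 H]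
      by (simp only: B_def level_idx3[OF ijk]) simp
    moreover have "(A *\<^sub>v (B *\<^sub>v (C *\<^sub>v (?K *\<^sub>v ?z)))) $ ?x =
        H $$ (i, j) * (B *\<^sub>v (C *\<^sub>v (?K *\<^sub>v ?z))) $ ?x"
      using on_qudits_ctrl_gate_mult_vec_index[OF _ _ _ B x, of 1 2 H]
      by (simp only: A_def level_idx3[OF ijk]) simp
    ultimately show ?thesis by simp
  qed
  ultimately have "((A * B * C * ?K) *\<^sub>v ?z) $ ?x = triangle_coeff H i j k"
    by (simp add: start triangle_coeff_def)
  moreover have "dim_vec ((A * B * C * ?K) *\<^sub>v ?z) = d ^ 3" using ABC by simp
  ultimately show ?thesis
    using x by (simp add: triangle_state_def A_def B_def C_def)
qed

section \<open>An identity for states that are LU equivalent to the GHZ state\<close>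

lemma mat_adjoint_carrier: "A \<in> carrier_mat m n \<Longrightarrow> mat_adjoint A \<in> carrier_mat n m"
  by (rule carrier_matI) (simp_all add: mat_adjoint_def)

lemma mat_adjoint_index:
  assumes "A \<in> carrier_mat m n" "i < n" "j < m"
  shows "mat_adjoint A $$ (i, j) = cnj (A $$ (j, i))"
  using assms by (simp add: mat_adjoint_def mat_of_rows_def)

lemma unitary_mat_columns:
  assumes U: "unitary_mat d U" and "i < d" "j < d"
  shows "(\<Sum>a<d. cnj (U $$ (a, i)) * U $$ (a, j)) = (if i = j then 1 else 0)"
proof -
  have c: "U \<in> carrier_mat d d" and e: "mat_adjoint U * U = 1\<^sub>m d"
    using U by (auto simp: unitary_mat_def)
  have "mat_adjoint U \<in> carrier_mat d d" using c by (rule mat_adjoint_carrier)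
  then have "(mat_adjoint U * U) $$ (i, j) = (\<Sum>a<d. cnj (U $$ (a, i)) * U $$ (a, j))"
    using c assms
    by (auto simp: scalar_prod_def lessThan_atLeast0 mat_adjoint_index[OF c] intro!: sum.cong)
  then show ?thesis using assms by (simp add: e)
qed

text \<open>A left inverse of a square matrix is also a right inverse, so orthonormality passes from
  the columns to the rows.\<close>

lemma unitary_mat_rows:
  assumes U: "unitary_mat d U" and "i < d" "j < d"
  shows "(\<Sum>a<d. cnj (U $$ (i, a)) * U $$ (j, a)) = (if i = j then 1 else 0)"
proof -
  have c: "U \<in> carrier_mat d d" and e: "mat_adjoint U * U = 1\<^sub>m d"
    using U by (auto simp: unitary_mat_def)
  have a: "mat_adjoint U \<in> carrier_mat d d" using c by (rule mat_adjoint_carrier)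
  have "(U * mat_adjoint U) $$ (j, i) = (\<Sum>a<d. cnj (U $$ (i, a)) * U $$ (j, a))"
    using a c assms
    by (auto simp: scalar_prod_def lessThan_atLeast0 mat_adjoint_index[OF c] intro!: sum.cong)
  moreover have "U * mat_adjoint U = 1\<^sub>m d"
    using mat_mult_left_right_inverse[OF a c e] .
  ultimately show ?thesis using assms by (cases "i = j") simp_all
qed

text \<open>The adjoint inverts \<open>U\<close>. This peels one local unitary off a nested
  sum.\<close>

lemma unitary_mat_solve:
  assumes U: "unitary_mat d U" and i: "i < d"
    and eq: "\<And>a. a < d \<Longrightarrow> (\<Sum>j<d. U $$ (a, j) * x j) = y a"
  shows "x i = (\<Sum>a<d. cnj (U $$ (a, i)) * y a)"
proof -
  have "(\<Sum>a<d. cnj (U $$ (a, i)) * y a) =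
      (\<Sum>a<d. \<Sum>j<d. cnj (U $$ (a, i)) * U $$ (a, j) * x j)"
    by (simp add: eq[symmetric] sum_distrib_left mult.assoc)
  also have "\<dots> = (\<Sum>j<d. (\<Sum>a<d. cnj (U $$ (a, i)) * U $$ (a, j)) * x j)"
    by (subst sum.swap) (simp add: sum_distrib_right)
  also have "\<dots> = (\<Sum>j<d. if i = j then x j else 0)"
    by (intro sum.cong refl) (simp add: unitary_mat_columns[OF U i])
  finally show ?thesis using i by simp
qed

text \<open>With the sum over \<open>m\<close> innermost, orthonormality of the rows of
  \<open>U\<close> forces \<open>s = t\<close>. This evaluates the inner index sums of a product of
  slices.\<close>

lemma unitary_mat_contract:
  assumes U: "unitary_mat d U"
  shows "(\<Sum>m<d. (\<Sum>s<d. p s * cnj (U $$ (s, m))) * (\<Sum>t<d. q t * U $$ (t, m))) =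
    (\<Sum>s<d. p s * q s)"
proof -
  have "(\<Sum>m<d. (\<Sum>s<d. p s * cnj (U $$ (s, m))) * (\<Sum>t<d. q t * U $$ (t, m))) =
      (\<Sum>m<d. \<Sum>s<d. \<Sum>t<d. p s * q t * (cnj (U $$ (s, m)) * U $$ (t, m)))"
    unfolding sum_product by (intro sum.cong refl) (simp add: ac_simps)
  also have "\<dots> = (\<Sum>s<d. \<Sum>t<d. \<Sum>m<d. p s * q t * (cnj (U $$ (s, m)) * U $$ (t, m)))"
    by (subst sum.swap) (intro sum.cong refl sum.swap)
  also have "\<dots> = (\<Sum>s<d. \<Sum>t<d. if s = t then p s * q t else 0)"
    by (intro sum.cong refl) (simp add: sum_distrib_left[symmetric] unitary_mat_rows[OF U])
  also have "\<dots> = (\<Sum>s<d. p s * q s)" by simp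
  finally show ?thesis .
qed

text \<open>Apply the adjoints of the local unitaries to the GHZ state: its coefficients vanish
  unless all three levels agree, so one sum over the common level \<open>s\<close> remains.\<close>

lemma lu_equivalent_ghz_coeff:
  assumes lu: "lu_equivalent d \<psi> (ghz_state d)" and \<psi>: "\<psi> \<in> carrier_vec (d ^ 3)"
  obtains A B C \<gamma> where "unitary_mat d A" "unitary_mat d B" "unitary_mat d C"
    "\<And>i j k. i < d \<Longrightarrow> j < d \<Longrightarrow> k < d \<Longrightarrow> \<psi> $ idx3 d i j k =
       \<gamma> * (\<Sum>s<d. cnj (A $$ (s, i)) * cnj (B $$ (s, j)) * cnj (C $$ (s, k)))"
proof -
  obtain A B C where U: "unitary_mat d A" "unitary_mat d B" "unitary_mat d C"
    and eq: "(A \<otimes>\<^sub>m B \<otimes>\<^sub>m C) *\<^sub>v \<psi> = ghz_state d"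
    using lu by (auto simp: lu_equivalent_def)
  then have c: "A \<in> carrier_mat d d" "B \<in> carrier_mat d d" "C \<in> carrier_mat d d"
    by (auto simp: unitary_mat_def)
  define \<gamma> where "\<gamma> = complex_of_real (1 / sqrt (real d))"
  have "\<psi> $ idx3 d i j k =
      \<gamma> * (\<Sum>s<d. cnj (A $$ (s, i)) * cnj (B $$ (s, j)) * cnj (C $$ (s, k)))"
    if ijk: "i < d" "j < d" "k < d" for i j k
  proof -
    \<comment> \<open>Three nested linear systems: \<open>A\<close> is inverted for fixed
      \<open>b\<close> and \<open>c\<close>, then \<open>B\<close> for fixed \<open>c\<close>,
      finally \<open>C\<close>.\<close>
    have "(\<Sum>i<d. A $$ (a, i) * (\<Sum>j<d. B $$ (b, j) * (\<Sum>k<d. C $$ (c, k) * \<psi> $ idx3 d i j k))) =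
        \<gamma> * (if a = b \<and> b = c then 1 else 0)" if "a < d" "b < d" "c < d" for a b c
      using kron3_mult_vec_index[OF c \<psi> that] ghz_state_idx3[OF that] by (simp add: eq \<gamma>_def)
    then have "(\<Sum>j<d. B $$ (b, j) * (\<Sum>k<d. C $$ (c, k) * \<psi> $ idx3 d i j k)) =
        (\<Sum>a<d. cnj (A $$ (a, i)) * (\<gamma> * (if a = b \<and> b = c then 1 else 0)))"
      if "b < d" "c < d" for b c
      using that by (intro unitary_mat_solve[OF U(1) ijk(1)])
    then have "(\<Sum>k<d. C $$ (c, k) * \<psi> $ idx3 d i j k) =
        (\<Sum>b<d. cnj (B $$ (b, j)) *
          (\<Sum>a<d. cnj (A $$ (a, i)) * (\<gamma> * (if a = b \<and> b = c then 1 else 0))))"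
      if "c < d" for c
      using that by (intro unitary_mat_solve[OF U(2) ijk(2)])
    then have "\<psi> $ idx3 d i j k = (\<Sum>c<d. cnj (C $$ (c, k)) * (\<Sum>b<d. cnj (B $$ (b, j)) *
        (\<Sum>a<d. cnj (A $$ (a, i)) * (\<gamma> * (if a = b \<and> b = c then 1 else 0)))))"
      by (intro unitary_mat_solve[OF U(3) ijk(3)])
    also have "\<dots> = (\<Sum>c<d. cnj (C $$ (c, k)) * (\<Sum>b<d. cnj (B $$ (b, j)) *
        (\<Sum>a<d. if a = b then if b = c then cnj (A $$ (b, i)) * \<gamma> else 0 else 0)))"
      by (intro sum.cong refl arg_cong2[where f = "(*)"]) auto
    also have "\<dots> = (\<Sum>c<d. cnj (C $$ (c, k)) *
        (\<Sum>b<d. if b = c then cnj (B $$ (c, j)) * (cnj (A $$ (c, i)) * \<gamma>) else 0))"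
      by (intro sum.cong refl arg_cong2[where f = "(*)"]) auto
    also have "\<dots> = \<gamma> * (\<Sum>s<d. cnj (A $$ (s, i)) * cnj (B $$ (s, j)) * cnj (C $$ (s, k)))"
      unfolding sum_distrib_left[where r = \<gamma>] by (intro sum.cong refl) (simp add: ac_simps)
    finally show ?thesis .
  qed
  then show ?thesis using U that by blast
qed

section \<open>Triple products of slices\<close>

text \<open>
  \<open>slice_product d t i j k a b\<close> is the entry \<open>(a, b)\<close> of \<open>T\<^sub>i T\<^sub>j\<^sup>\<dagger> T\<^sub>k\<close>, where the matrix \<open>T\<^sub>i\<close>
  has entries \<open>t i a b\<close>.
\<close>

definition slice_product ::
  "nat \<Rightarrow> (nat \<Rightarrow> nat \<Rightarrow> nat \<Rightarrow> complex) \<Rightarrow> nat \<Rightarrow> nat \<Rightarrow> nat \<Rightarrow> nat \<Rightarrow> nat \<Rightarrow> complex" where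
  "slice_product d t i j k a b = (\<Sum>n<d. (\<Sum>m<d. t i a m * cnj (t j n m)) * t k n b)"

lemma slice_product_scale:
  "slice_product d (\<lambda>i j k. c * t i j k) i j k a b = c * cnj c * c * slice_product d t i j k a b"
  unfolding slice_product_def sum_distrib_left sum_distrib_right
  by (intro sum.cong refl) (simp add: ac_simps)

lemma slice_product_cong:
  assumes "\<And>i j k. i < d \<Longrightarrow> j < d \<Longrightarrow> k < d \<Longrightarrow> t i j k = u i j k"
    and "i < d" "j < d" "k < d" "a < d" "b < d"
  shows "slice_product d t i j k a b = slice_product d u i j k a b"
  using assms by (auto simp: slice_product_def intro!: sum.cong)

text \<open>As matrices, the slices are \<open>T\<^sub>i = B\<^sup>\<dagger> D\<^sub>i C'\<close>,
  where \<open>D\<^sub>i\<close> is diagonal with entries \<open>cnj (A $$ (s, i))\<close> and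
  \<open>C'\<close> is the entrywise conjugate of \<open>C\<close>. The inner unitaries cancel and
  leave \<open>B\<^sup>\<dagger> D\<^sub>i D\<^sub>j\<^sup>\<dagger> D\<^sub>k C'\<close>.\<close>

lemma slice_product_decomposed:
  assumes U: "unitary_mat d B" "unitary_mat d C"
  shows "slice_product d
      (\<lambda>i j k. \<Sum>s<d. cnj (A $$ (s, i)) * cnj (B $$ (s, j)) * cnj (C $$ (s, k))) i j k a b =
    (\<Sum>s<d. cnj (A $$ (s, i)) * A $$ (s, j) * cnj (A $$ (s, k)) *
      cnj (B $$ (s, a)) * cnj (C $$ (s, b)))"
    (is "slice_product d ?t i j k a b = _")
proof -
  \<comment> \<open>The index \<open>m\<close> occurs only in \<open>C\<close>, which cancels here;
    the index \<open>n\<close> then cancels \<open>B\<close>.\<close>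
  have inner: "(\<Sum>m<d. ?t i a m * cnj (?t j n m)) =
      (\<Sum>s<d. cnj (A $$ (s, i)) * cnj (B $$ (s, a)) * A $$ (s, j) * B $$ (s, n))" for n
    using unitary_mat_contract[OF U(2), of "\<lambda>s. cnj (A $$ (s, i)) * cnj (B $$ (s, a))"
        "\<lambda>s. A $$ (s, j) * B $$ (s, n)"]
    by (simp add: cnj_sum mult.assoc)
  have "slice_product d ?t i j k a b =
      (\<Sum>n<d. (\<Sum>s<d. (cnj (A $$ (s, k)) * cnj (C $$ (s, b))) * cnj (B $$ (s, n))) *
        (\<Sum>s<d. (cnj (A $$ (s, i)) * cnj (B $$ (s, a)) * A $$ (s, j)) * B $$ (s, n)))"
    unfolding slice_product_def inner by (simp add: ac_simps)
  also have "\<dots> = (\<Sum>s<d. (cnj (A $$ (s, k)) * cnj (C $$ (s, b))) *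
      (cnj (A $$ (s, i)) * cnj (B $$ (s, a)) * A $$ (s, j)))"
    by (rule unitary_mat_contract[OF U(1)])
  finally show ?thesis by (simp add: ac_simps)
qed

lemma lu_equivalent_ghz_slice_product:
  assumes lu: "lu_equivalent d \<psi> (ghz_state d)" and \<psi>: "\<psi> \<in> carrier_vec (d ^ 3)"
    and less: "i < d" "j < d" "k < d" "a < d" "b < d"
  shows "slice_product d (\<lambda>i j k. \<psi> $ idx3 d i j k) i j k a b =
    slice_product d (\<lambda>i j k. \<psi> $ idx3 d i j k) k j i a b"
proof -
  obtain A B C \<gamma> where U: "unitary_mat d A" "unitary_mat d B" "unitary_mat d C"
    and eq: "\<And>i j k. i < d \<Longrightarrow> j < d \<Longrightarrow> k < d \<Longrightarrow> \<psi> $ idx3 d i j k =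
       \<gamma> * (\<Sum>s<d. cnj (A $$ (s, i)) * cnj (B $$ (s, j)) * cnj (C $$ (s, k)))"
    by (rule lu_equivalent_ghz_coeff[OF lu \<psi>]) (rule that)
  note expand = slice_product_cong[OF eq] slice_product_scale slice_product_decomposed[OF U(2,3)]
  \<comment> \<open>After expansion the two sides differ only in the order of the scalar factors
    from \<open>A\<close>, since diagonal matrices commute.\<close>
  show ?thesis using less by (simp add: expand) (simp add: ac_simps)
qed

section \<open>The Paley matrix of order six\<close>

text \<open>Indices 1 to 5 stand for the residues modulo 5, with 5 as 0, and index 0 is the border.
  On natural numbers \<open>i + 4 * j\<close> replaces the difference \<open>i - j\<close> modulo 5;
  1 and 4 are the nonzero squares.\<close>

definition paley6 :: "complex mat" where
  "paley6 = mat 6 6 (\<lambda>(i, j).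
     if i = j then \<i> else if i = 0 \<or> j = 0 \<or> (i + 4 * j) mod 5 \<in> {1, 4} then 1 else -1)"

lemma lessThan_6: "{..<6::nat} = {0, 1, 2, 3, 4, 5}"
  by auto

lemma all_less_6: "(\<forall>i<6. P i) \<longleftrightarrow> P 0 \<and> P 1 \<and> P 2 \<and> P 3 \<and> P 4 \<and> P (5::nat)"
proof -
  have "(\<forall>i<6. P i) \<longleftrightarrow> (\<forall>i\<in>{..<6}. P i)" by blast
  then show ?thesis unfolding lessThan_6 by blast
qed

lemma sum_less_6:
  "(\<Sum>i<6. f i) = f 0 + (f 1 + (f 2 + (f 3 + (f 4 + f (5::nat)))))" for f :: "nat \<Rightarrow> complex"
  unfolding lessThan_6 by simp

lemma paley6_carrier: "paley6 \<in> carrier_mat 6 6"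
  by (simp add: paley6_def)

text \<open>The conference matrix \<open>C\<close> is real symmetric with square \<open>5 I\<close>,
  so the product of \<open>C - \<i> I\<close> and \<open>C + \<i> I\<close> is \<open>6 I\<close>.
  The proof evaluates all entries directly.\<close>

lemma complex_hadamard_paley6: "complex_hadamard 6 paley6"
proof -
  have "mat_adjoint paley6 * paley6 = of_nat 6 \<cdot>\<^sub>m 1\<^sub>m 6"
  proof (rule eq_matI)
    fix i j assume "i < dim_row (of_nat 6 \<cdot>\<^sub>m 1\<^sub>m 6 :: complex mat)"
      "j < dim_col (of_nat 6 \<cdot>\<^sub>m 1\<^sub>m 6 :: complex mat)"
    then have ij: "i < 6" "j < 6" by auto
    have a: "mat_adjoint paley6 \<in> carrier_mat 6 6" using paley6_carrier by (rule mat_adjoint_carrier)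
    have "(mat_adjoint paley6 * paley6) $$ (i, j) =
        (\<Sum>k<6. cnj (paley6 $$ (k, i)) * paley6 $$ (k, j))"
      using a paley6_carrier ij
      by (auto simp: scalar_prod_def lessThan_atLeast0 mat_adjoint_index[OF paley6_carrier]
          intro!: sum.cong)
    also have "\<dots> = (if i = j then 6 else 0)"
    proof -
      have "\<forall>i<6. \<forall>j<6. (\<Sum>k<6. cnj (paley6 $$ (k, i)) * paley6 $$ (k, j)) =
          (if i = j then 6 else 0)"
        unfolding all_less_6 sum_less_6 by (simp add: paley6_def)
      then show ?thesis using ij by blast
    qed
    finally show "(mat_adjoint paley6 * paley6) $$ (i, j) = (of_nat 6 \<cdot>\<^sub>m 1\<^sub>m 6) $$ (i, j)"
      using ij by simp
  qed (use mat_adjoint_carrier[OF paley6_carrier] paley6_carrier in auto)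
  then show ?thesis
    using paley6_carrier by (simp add: complex_hadamard_def paley6_def)
qed

text \<open>Underlying reason: -1 is a square modulo 5, so \<open>i - j\<close> and
  \<open>j - i\<close> are squares together.\<close>

lemma symmetric_mat_paley6: "symmetric_mat paley6"
proof -
  have "\<forall>i<6. \<forall>j<6. paley6 $$ (j, i) = paley6 $$ (i, j)"
    unfolding all_less_6 by (simp add: paley6_def)
  then show ?thesis
    using paley6_carrier by (auto simp: symmetric_mat_def)
qed

text \<open>Direct evaluation: the two entries are \<open>4 - 6 * \<i>\<close> and
  \<open>4 + 2 * \<i>\<close>, which differ in the imaginary part.\<close>

lemma slice_product_paley6:
  "slice_product 6 (triangle_coeff paley6) 0 1 2 0 2 \<noteq>
   slice_product 6 (triangle_coeff paley6) 2 1 0 0 2"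
  unfolding slice_product_def sum_less_6 triangle_coeff_def
  by (simp add: paley6_def complex_eq_iff)

theorem proposition20:
  shows "\<exists>(d::nat) (H::complex mat).
           d \<ge> 2 \<and> complex_hadamard d H \<and> symmetric_mat H \<and>
           \<not> lu_equivalent d (triangle_state d H) (ghz_state d)"
proof (intro exI conjI notI)
  \<comment> \<open>These facts fix the witnesses \<open>d = 6\<close> and
    \<open>H = paley6\<close>.\<close>
  show "complex_hadamard 6 paley6" "symmetric_mat paley6"
    by (fact complex_hadamard_paley6 symmetric_mat_paley6)+
  \<comment> \<open>The normalization multiplies both slice products by the same nonzero number
    \<open>c * cnj c * c\<close>, so the inequality for the bare coefficients carries over.\<close>
  define c where "c = complex_of_real (1 / real 6 powr (3 / 2))"
  have c: "c \<noteq> 0" by (simp add: c_def)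
  assume "lu_equivalent 6 (triangle_state 6 paley6) (ghz_state 6)"
  from lu_equivalent_ghz_slice_product[OF this triangle_state_carrier, of 0 1 2 0 2]
  have "slice_product 6 (\<lambda>i j k. c * triangle_coeff paley6 i j k) 0 1 2 0 2 =
      slice_product 6 (\<lambda>i j k. c * triangle_coeff paley6 i j k) 2 1 0 0 2"
    by (simp add: slice_product_cong[OF triangle_state_idx3[OF paley6_carrier]] c_def)
  then show False using c slice_product_paley6 by (simp add: slice_product_scale)
qed simp

end
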